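(* Let $p$ be an odd prime, $d\ge 2$ an integer, $c\in\mathbb{F}_p^\times$, and $N_d=1+\#\{(x,y)\in\mathbb{F}_p^2: y^2=x^d+cx\}$. Let $T$ be a fixed generator of $\widehat{\mathbb{F}_p^\times}$ and $\phi=T^{(p-1)/2}$. Then $$N_d=p+1+\sum_{m} T_{d'}^{2m+1}(-c)\,\phi(c)\,J(T_{d'}^{2m+1},\phi),$$ where the sum is over all $m\in\mathbb{Z}$ such that $\frac{(2m+1)(p-1)}{2(d-1)}$ is an integer lying in $[0,p-2]$, and $T_{d'}^{2m+1}$ denotes the character $T^{(2m+1)(p-1)/(2(d-1))}$.
   Context: Multiplicative characters are extended to $\mathbb{F}_p$ by $\chi(0)=0$. The Jacobi sum is $J(A,B)=\sum_{x\in\mathbb{F}_p}A(x)B(1-x)$. *)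

theory Defs
  imports
    Complex_Main
    "HOL-Algebra.Generated_Groups"
    "Berlekamp_Zassenhaus.Finite_Field"
begin

text \<open>
  The group of multiplicative characters of a field. Each character is represented by its
  extension by \<open>0\<close> at \<open>0\<close>; in particular the neutral element vanishes at \<open>0\<close>.
\<close>

definition mult_chars :: "('a::field \<Rightarrow> complex) monoid" where
  "mult_chars =
     \<lparr>carrier = {\<chi>. \<chi> 0 = 0 \<and> \<chi> 1 = 1 \<and> (\<forall>x y. \<chi> (x * y) = \<chi> x * \<chi> y)},
      monoid.mult = (\<lambda>\<chi> \<psi> x. \<chi> x * \<psi> x),
      one = (\<lambda>x. if x = 0 then 0 else 1)\<rparr>"

lemma comm_group_mult_chars: "comm_group (mult_chars :: ('a::field \<Rightarrow> complex) monoid)"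
proof (rule comm_groupI)
  fix \<chi> :: "'a \<Rightarrow> complex"
  assume "\<chi> \<in> carrier mult_chars"
  then have \<chi>: "\<chi> 0 = 0" "\<chi> 1 = 1" "\<And>x y. \<chi> (x * y) = \<chi> x * \<chi> y"
    by (auto simp: mult_chars_def)
  have nz: "\<chi> x \<noteq> 0" if "x \<noteq> 0" for x
    using \<chi>(3)[of x "inverse x"] \<chi>(2) that by auto
  show "\<exists>\<psi>\<in>carrier mult_chars. \<psi> \<otimes>\<^bsub>mult_chars\<^esub> \<chi> = \<one>\<^bsub>mult_chars\<^esub>"
    by (rule bexI[where x = "\<lambda>x. inverse (\<chi> x)"]) (use \<chi> nz in \<open>auto simp: mult_chars_def\<close>)
qed (auto simp: mult_chars_def)

definition is_generator :: "('g, 'm) monoid_scheme \<Rightarrow> 'g \<Rightarrow> bool" where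
  "is_generator G g \<longleftrightarrow> g \<in> carrier G \<and> generate G {g} = carrier G"

definition jacobi_sum :: "('a::{field,finite} \<Rightarrow> complex) \<Rightarrow> ('a \<Rightarrow> complex) \<Rightarrow> complex" where
  "jacobi_sum A B = (\<Sum>x\<in>UNIV. A x * B (1 - x))"

definition curve_points :: "nat \<Rightarrow> 'a::{field,finite} \<Rightarrow> nat" where
  "curve_points d c = 1 + card {(x, y). y ^ 2 = x ^ d + c * x}"

text \<open>
  The integers \<open>m\<close> for which \<open>(2m + 1)(p - 1) / (2(d - 1))\<close> is an integer in \<open>[0, p - 2]\<close>;
  under the divisibility condition, \<open>div\<close> is the exact quotient.
\<close>

definition char_exponent :: "nat \<Rightarrow> nat \<Rightarrow> int \<Rightarrow> int" where
  "char_exponent p d m = ((2 * m + 1) * (int p - 1)) div (2 * (int d - 1))"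

definition index_set :: "nat \<Rightarrow> nat \<Rightarrow> int set" where
  "index_set p d =
     {m. 2 * (int d - 1) dvd (2 * m + 1) * (int p - 1) \<and>
         char_exponent p d m \<in> {0..int p - 2}}"

lemma finite_index_set:
  assumes "p \<ge> 2" "d \<ge> 2"
  shows "finite (index_set p d)"
proof (rule inj_on_finite)
  show "char_exponent p d ` index_set p d \<subseteq> {0..int p - 2}"
    by (auto simp: index_set_def)
  show "inj_on (char_exponent p d) (index_set p d)"
  proof (rule inj_onI)
    fix m n
    assume "m \<in> index_set p d" "n \<in> index_set p d" "char_exponent p d m = char_exponent p d n"
    then have "(2 * m + 1) * (int p - 1) = (2 * n + 1) * (int p - 1)"
      unfolding index_set_def char_exponent_def mem_Collect_eq
      by (blast intro: iffD1[OF dvd_div_eq_iff])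
    then show "m = n" using assms by simp
  qed
qed simp

end

theory Submission
  imports
    Defs
    "HOL-Algebra.Multiplicative_Group"
    "HOL-Number_Theory.Cong"
    "HOL-Analysis.Complex_Transcendental"
begin

text \<open>
  Counting square roots by \<open>1 + \<phi>\<close>, one gets \<open>N\<^sub>d = p + 1 + \<Sum>\<^sub>x \<phi>(x\<^sup>d + cx)\<close>, and
  \<open>\<phi>(x\<^sup>d + cx) = \<phi>(c) \<phi>(x) \<phi>(1 - u)\<close> with \<open>u = - x\<^bsup>d-1\<^esup> / c\<close>. Summing over the fibres of
  \<open>x \<mapsto> u\<close>, orthogonality turns the sum of \<open>\<phi>(x)\<close> over the solutions of \<open>x\<^bsup>d-1\<^esup> = - c u\<close> into
  the sum of \<open>\<psi>(- c u)\<close> over the characters \<open>\<psi>\<close> with \<open>\<psi>\<^bsup>d-1\<^esup> = \<phi>\<close>, and the remaining sum over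
  \<open>u\<close> is \<open>J(\<psi>, \<phi>)\<close>. Writing \<open>\<psi> = T\<^sup>k\<close>, the condition is \<open>2(d - 1)k = (2m + 1)(p - 1)\<close> for some
  integer \<open>m\<close>. Orthogonality over the powers of \<open>T\<close> holds because \<open>T\<close> is faithful.
\<close>

section \<open>The unit group of a finite field is cyclic\<close>

lemma finite_field_power_card_minus_1:
  fixes x :: "'a::{field,finite}"
  assumes "x \<noteq> 0"
  shows "x ^ (CARD('a) - 1) = 1"
proof -
  let ?P = "\<Prod>y\<in>UNIV - {0::'a}. y"
  have "?P = (\<Prod>y\<in>UNIV - {0}. x * y)"
    by (rule prod.reindex_bij_witness[of _ "\<lambda>y. x * y" "\<lambda>y. y / x"]) (use assms in auto)
  also have "\<dots> = x ^ (CARD('a) - 1) * ?P"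
    by (simp add: prod.distrib)
  finally show ?thesis
    by simp
qed

lemma finite_field_primitive_element:
  obtains g :: "'a::{field,finite}"
  where "g \<noteq> 0" "\<And>x. x \<noteq> 0 \<Longrightarrow> \<exists>k. x = g ^ k"
proof -
  \<comment> \<open>The field operations are packed into a record so that the cyclicity of the unit
    group, known for fields with explicit carriers, carries over to the type class.\<close>
  define R :: "'a ring" where
    "R = \<lparr>carrier = UNIV, monoid.mult = (*), one = 1, zero = 0, add = (+)\<rparr>"
  have neg: "\<exists>y. x + y = 0" for x :: 'a
    by (rule exI[of _ "- x"]) simp
  interpret R: cring R
    by (intro cringI abelian_groupI comm_monoidI)
      (simp_all add: R_def neg add_ac mult_ac distrib_left)
  interpret R: Ring.field R
  proof (rule R.cring_fieldI2)
    show "\<zero>\<^bsub>R\<^esub> \<noteq> \<one>\<^bsub>R\<^esub>"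
      by (simp add: R_def)
    show "\<exists>b\<in>carrier R. a \<otimes>\<^bsub>R\<^esub> b = \<one>\<^bsub>R\<^esub>" if "a \<noteq> \<zero>\<^bsub>R\<^esub>" for a
      using that by (intro bexI[of _ "inverse a"]) (auto simp: R_def)
  qed
  have pow: "x [^]\<^bsub>R\<^esub> (k::nat) = x ^ k" for x k
    by (induction k) (auto simp: R_def)
  obtain g where g: "g \<in> carrier (mult_of R)"
      "carrier (mult_of R) = {g [^]\<^bsub>R\<^esub> k |k::nat. k \<in> UNIV}"
    using R.finite_field_mult_group_has_gen by auto
  have "carrier (mult_of R) = UNIV - {0}"
    by (auto simp: R_def)
  with g show ?thesis
    by (intro that[of g]) (auto simp: pow set_eq_iff)
qed

lemma primitive_element_power_eq_1_iff:
  fixes g :: "'a::{field,finite}"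
  assumes "g \<noteq> 0" "\<And>x. x \<noteq> 0 \<Longrightarrow> \<exists>k. x = g ^ k"
  shows "g ^ k = 1 \<longleftrightarrow> (CARD('a) - 1) dvd k"
proof -
  have periodic: "g ^ k = g ^ (k mod i)" if "g ^ i = 1" for i k
  proof -
    have "g ^ k = g ^ (i * (k div i) + k mod i)"
      by simp
    also have "\<dots> = g ^ (k mod i)"
      unfolding power_add power_mult that by simp
    finally show ?thesis .
  qed
  \<comment> \<open>By periodicity the first \<open>i\<close> powers of \<open>g\<close> already
    cover all units, so there are at most \<open>i\<close> units.\<close>
  have minimal: "CARD('a) - 1 \<le> i" if "g ^ i = 1" "i > 0" for i
  proof -
    have "UNIV - {0} \<subseteq> (\<lambda>k. g ^ k) ` {..<i}"
    proof
      fix x :: 'a assume "x \<in> UNIV - {0}"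
      with assms(2) obtain k where "x = g ^ k"
        by auto
      with periodic[OF that(1), of k] that(2) show "x \<in> (\<lambda>k. g ^ k) ` {..<i}"
        by (intro image_eqI[of _ _ "k mod i"]) auto
    qed
    then have "card (UNIV - {0::'a}) \<le> card {..<i}"
      by (rule surj_card_le[rotated]) simp
    then show ?thesis
      by simp
  qed
  have one: "g ^ (CARD('a) - 1) = 1"
    using assms(1) by (rule finite_field_power_card_minus_1)
  have pos: "CARD('a) - 1 > 0"
    using card_mono[of UNIV "{0,1::'a}"] by simp
  show ?thesis
  proof
    assume "g ^ k = 1"
    then have "g ^ (k mod (CARD('a) - 1)) = 1"
      using periodic[OF one] by simp
    with minimal have "\<not> k mod (CARD('a) - 1) > 0"
      using pos by (meson linorder_not_less mod_less_divisor)
    then show "(CARD('a) - 1) dvd k"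
      by auto
  next
    assume "(CARD('a) - 1) dvd k"
    then show "g ^ k = 1"
      using periodic[OF one, of k] by simp
  qed
qed

lemma primitive_element_power_eq_iff:
  fixes g :: "'a::{field,finite}"
  assumes "g \<noteq> 0" "\<And>x. x \<noteq> 0 \<Longrightarrow> \<exists>k. x = g ^ k"
  shows "g ^ i = g ^ j \<longleftrightarrow> [i = j] (mod (CARD('a) - 1))"
proof (induction i j rule: linorder_wlog)
  case (le i j)
  then have "g ^ j = g ^ i * g ^ (j - i)"
    by (simp flip: power_add)
  then have "g ^ i = g ^ j \<longleftrightarrow> g ^ (j - i) = 1"
    using assms(1) by simp
  also have "\<dots> \<longleftrightarrow> (CARD('a) - 1) dvd (j - i)"
    by (rule primitive_element_power_eq_1_iff[OF assms])
  also have "\<dots> \<longleftrightarrow> [j = i] (mod (CARD('a) - 1))"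
    using le by (rule cong_altdef_nat[symmetric])
  also have "\<dots> \<longleftrightarrow> [i = j] (mod (CARD('a) - 1))"
    by (rule cong_sym_eq)
  finally show ?case .
next
  case (sym i j)
  then show ?case
    by (simp only: cong_sym_eq[of j i] eq_commute[of "g ^ j"])
qed

section \<open>Faithful characters\<close>

text \<open>Take the discrete logarithm to a primitive base \<open>g\<close> and apply a primitive
  \<open>n\<close>-th root of unity to it. Powers of \<open>g\<close> and of the root coincide for
  exactly the same exponents, which gives both well-definedness and faithfulness.\<close>

lemma faithful_character_exists:
  obtains \<eta> :: "'a::{field,finite} \<Rightarrow> complex"
  where "\<eta> \<in> carrier mult_chars" "\<And>x. \<eta> x = 1 \<Longrightarrow> x = 1"
proof -
  obtain g :: 'a where g: "g \<noteq> 0" "\<And>x. x \<noteq> 0 \<Longrightarrow> \<exists>k. x = g ^ k"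
    by (rule finite_field_primitive_element) blast
  define n where "n = CARD('a) - 1"
  have "n \<ge> 1"
    using card_mono[of UNIV "{0,1::'a}"] by (simp add: n_def)
  define e :: "nat \<Rightarrow> complex" where "e k = exp (2 * of_real pi * \<i> * of_nat k / of_nat n)" for k
  have e_eq: "e i = e j \<longleftrightarrow> g ^ i = g ^ j" for i j
    using complex_root_unity_eq[OF \<open>n \<ge> 1\<close>, of i j] primitive_element_power_eq_iff[OF g, of i j]
    by (simp add: e_def n_def cong_def)
  have e_add: "e (i + j) = e i * e j" for i j
    by (simp add: e_def ring_distribs add_divide_distrib exp_add)
  have e_0: "e 0 = 1"
    by (simp add: e_def)
  \<comment> \<open>The logarithm is determined only modulo \<open>n\<close>, hence additive only
    modulo \<open>n\<close>; \<open>e_eq\<close> makes \<open>e (l x)\<close> independent of the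
    choice.\<close>
  define l where "l x = (SOME k. x = g ^ k)" for x
  have l: "g ^ l x = x" if "x \<noteq> 0" for x
    using someI_ex[OF g(2)[OF that]] by (simp add: l_def)
  define \<eta> where "\<eta> x = (if x = 0 then 0 else e (l x))" for x
  have \<eta>_mult: "\<eta> (x * y) = \<eta> x * \<eta> y" for x y
  proof (cases "x = 0 \<or> y = 0")
    case False
    then have "e (l (x * y)) = e (l x + l y)"
      unfolding e_eq by (simp add: power_add l)
    with False show ?thesis
      by (simp add: \<eta>_def e_add)
  qed (auto simp: \<eta>_def)
  have \<eta>_eq_1_iff: "\<eta> x = 1 \<longleftrightarrow> x = 1" for x
    using e_eq[of "l x" 0] l[of x] by (cases "x = 0") (auto simp: \<eta>_def e_0)
  show ?thesis
    by (rule that[of \<eta>]) (auto simp: mult_chars_def \<eta>_mult \<eta>_eq_1_iff, simp add: \<eta>_def)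
qed

text \<open>The case split matters for \<open>k = 0\<close>: the neutral character vanishes at 0,
  whereas \<open>T 0 ^ 0\<close> is 1.\<close>

lemma mult_chars_nat_pow:
  assumes "T \<in> carrier mult_chars"
  shows "(T [^]\<^bsub>mult_chars\<^esub> (k::nat)) x = (if x = 0 then 0 else T x ^ k)"
  using assms by (induction k) (auto simp: mult_chars_def)

text \<open>Every character is a power of the generator, hence trivial wherever the generator is.\<close>

lemma generator_faithful:
  fixes T :: "'a::{field,finite} \<Rightarrow> complex"
  assumes "is_generator mult_chars T" "T a = 1"
  shows "a = 1"
proof -
  interpret comm_group "mult_chars :: ('a \<Rightarrow> complex) monoid"
    by (rule comm_group_mult_chars)
  obtain \<eta> :: "'a \<Rightarrow> complex" where \<eta>: "\<eta> \<in> carrier mult_chars" "\<And>x. \<eta> x = 1 \<Longrightarrow> x = 1"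
    by (rule faithful_character_exists) blast
  have T: "T \<in> carrier mult_chars" "generate mult_chars {T} = carrier mult_chars"
    using assms(1) by (auto simp: is_generator_def)
  have "a \<noteq> 0"
    using T(1) assms(2) by (auto simp: mult_chars_def)
  have inv_eval: "(inv\<^bsub>mult_chars\<^esub> \<psi>) a = 1" if "\<psi> \<in> carrier mult_chars" "\<psi> a = 1" for \<psi>
    using fun_cong[OF l_inv[OF that(1)], of a] that(2) \<open>a \<noteq> 0\<close> by (simp add: mult_chars_def)
  have "\<psi> a = 1" if "\<psi> \<in> generate mult_chars {T}" for \<psi>
    using that
  proof induction
    case one
    show ?case using \<open>a \<noteq> 0\<close> by (simp add: mult_chars_def)
  next
    case (incl h)
    then show ?case using assms(2) by simp
  next
    case (inv h)
    then show ?case using inv_eval T(1) assms(2) by simp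
  next
    case (eng h1 h2)
    then show ?case by (simp add: mult_chars_def)
  qed
  \<comment> \<open>The faithful character \<eta> itself lies in the generated group, so
    \<open>\<eta> a = 1\<close>.\<close>
  with \<eta> T(2) show ?thesis
    by blast
qed

section \<open>Orthogonality relations\<close>

text \<open>The plain powers \<open>T x ^ k\<close> with \<open>k < n\<close> stand in for the
  characters, so that sums over characters become sums over natural exponents.\<close>

locale faithful_character =
  fixes T :: "'a::{field,finite} \<Rightarrow> complex" and n :: nat
  assumes char_0: "T 0 = 0"
    and char_1: "T 1 = 1"
    and char_mult: "T (x * y) = T x * T y"
    and char_eq_1: "T x = 1 \<Longrightarrow> x = 1"
  defines "n \<equiv> CARD('a) - 1"
begin

lemma n_pos: "n > 0"
  using card_mono[of UNIV "{0,1::'a}"] by (simp add: n_def)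

lemma char_power: "T (x ^ k) = T x ^ k"
  by (induction k) (auto simp: char_1 char_mult)

lemma char_power_n: "x \<noteq> 0 \<Longrightarrow> T x ^ n = 1"
  using finite_field_power_card_minus_1[of x] by (simp add: n_def char_1 flip: char_power)

text \<open>For a unit \<open>a\<close> other than 1, faithfulness makes \<open>T a\<close> an
  \<open>n\<close>-th root of unity different from 1, so the geometric sum vanishes.\<close>

lemma sum_char_powers:
  assumes "a \<noteq> 0"
  shows "(\<Sum>k<n. T a ^ k) = (if a = 1 then of_nat n else 0)"
proof (cases "a = 1")
  case True
  then show ?thesis by (simp add: char_1)
next
  case False
  then have "T a \<noteq> 1"
    using char_eq_1 by blast
  then show ?thesis
    using False char_power_n[OF assms] by (simp add: geometric_sum)
qed

text \<open>If \<open>n\<close> does not divide \<open>k\<close>, the substitution of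
  \<open>g * x\<close> for \<open>x\<close> multiplies the sum by \<open>T g ^ k\<close>, which is
  not 1 for primitive \<open>g\<close>.\<close>

lemma sum_char_units:
  "(\<Sum>x\<in>UNIV - {0}. T x ^ k) = (if n dvd k then of_nat n else 0)"
proof (cases "n dvd k")
  case True
  then obtain m where "k = n * m" ..
  then show ?thesis
    by (simp add: power_mult char_power_n) (simp add: n_def)
next
  case False
  obtain g :: 'a where g: "g \<noteq> 0" "\<And>x. x \<noteq> 0 \<Longrightarrow> \<exists>k. x = g ^ k"
    by (rule finite_field_primitive_element) blast
  have "T g ^ k \<noteq> 1"
    using char_eq_1[of "g ^ k"] primitive_element_power_eq_1_iff[OF g, of k] False
    by (auto simp: char_power n_def)
  moreover have "(\<Sum>x\<in>UNIV - {0}. T x ^ k) = T g ^ k * (\<Sum>x\<in>UNIV - {0}. T x ^ k)"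
    unfolding sum_distrib_left power_mult_distrib[symmetric] char_mult[symmetric]
    by (rule sum.reindex_bij_witness[of _ "\<lambda>x. g * x" "\<lambda>x. x / g"]) (use g(1) in auto)
  ultimately show ?thesis
    using False by simp
qed

text \<open>The condition \<open>x ^ r = a\<close> is detected by summing all characters over \<open>a / x ^ r\<close>.\<close>

lemma sum_char_over_roots:
  assumes "a \<noteq> 0"
  shows "(\<Sum>x | x \<noteq> 0 \<and> x ^ r = a. T x ^ j) = (\<Sum>k | k < n \<and> [r * k = j] (mod n). T a ^ k)"
proof -
  \<comment> \<open>The inverse of a unit is its power with exponent \<open>n - 1\<close>; this
    keeps exponents natural, and \<open>n - 1\<close> acts as -1 modulo \<open>n\<close>.\<close>
  have inv_power: "T (a / x ^ r) ^ k = T a ^ k * T x ^ ((n - 1) * (r * k))" if "x \<noteq> 0" for x k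
  proof -
    have "x * x ^ (n - 1) = 1"
      using finite_field_power_card_minus_1[OF that] n_pos
      by (simp only: power_Suc[symmetric] n_def Suc_diff_1)
    then have "inverse x = x ^ (n - 1)"
      by (rule inverse_unique)
    then have "a / x ^ r = a * (x ^ (n - 1)) ^ r"
      by (metis divide_inverse power_inverse)
    then show ?thesis
      by (simp add: char_mult char_power power_mult_distrib power_mult mult.assoc)
  qed
  have dvd_iff: "n dvd (n - 1) * (r * k) + j \<longleftrightarrow> [r * k = j] (mod n)" for k
  proof -
    have "n dvd (n - 1) * (r * k) + j \<longleftrightarrow> int n dvd (int n - 1) * (int r * int k) + int j"
      using n_pos by (simp flip: int_dvd_int_iff add: of_nat_diff)
    also have "(int n - 1) * (int r * int k) + int j =
        int n * (int r * int k) - (int r * int k - int j)"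
      by (simp add: algebra_simps)
    also have "int n dvd \<dots> \<longleftrightarrow> int n dvd int r * int k - int j"
      by (metis dvd_diff_commute dvd_triv_left dvd_add_right_iff diff_conv_add_uminus dvd_minus_iff)
    also have "\<dots> \<longleftrightarrow> [r * k = j] (mod n)"
      by (simp add: cong_iff_dvd_diff flip: cong_int_iff)
    finally show ?thesis .
  qed
  \<comment> \<open>Orthogonality is used twice: over the exponents it expresses the root condition,
    over the units it selects the admissible \<open>k\<close>. Each use contributes a factor
    \<open>n\<close>, and the two cancel.\<close>
  have "of_nat n * (\<Sum>x | x \<noteq> 0 \<and> x ^ r = a. T x ^ j) =
      (\<Sum>x\<in>UNIV - {0}. T x ^ j * (if a / x ^ r = 1 then of_nat n else 0))"
    unfolding sum_distrib_left
    by (rule sum.mono_neutral_cong_left) auto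
  also have "\<dots> = (\<Sum>x\<in>UNIV - {0}. T x ^ j * (\<Sum>k<n. T (a / x ^ r) ^ k))"
    by (rule sum.cong) (use assms in \<open>auto simp: sum_char_powers\<close>)
  also have "\<dots> = (\<Sum>x\<in>UNIV - {0}. \<Sum>k<n. T a ^ k * T x ^ ((n - 1) * (r * k) + j))"
    by (rule sum.cong) (auto simp: inv_power sum_distrib_left power_add mult_ac)
  also have "\<dots> = (\<Sum>k<n. T a ^ k * (\<Sum>x\<in>UNIV - {0}. T x ^ ((n - 1) * (r * k) + j)))"
    unfolding sum_distrib_left by (rule sum.swap)
  also have "\<dots> = (\<Sum>k<n. T a ^ k * (if [r * k = j] (mod n) then of_nat n else 0))"
    by (simp only: sum_char_units dvd_iff)
  also have "\<dots> = of_nat n * (\<Sum>k | k < n \<and> [r * k = j] (mod n). T a ^ k)"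
    unfolding sum_distrib_left
    by (rule sum.mono_neutral_cong_right) auto
  finally show ?thesis
    using n_pos by simp
qed

section \<open>Point counts as character sums\<close>

text \<open>For \<open>a\<close> nonzero this is \<open>sum_char_over_roots\<close> with
  \<open>r = 2\<close> and \<open>j = 0\<close>: the only exponents below \<open>n\<close> whose
  double is divisible by \<open>n\<close> are 0 and \<open>n div 2\<close>.\<close>

lemma card_square_roots:
  assumes "even n"
  shows "of_nat (card {y. y ^ 2 = a}) = 1 + (if a = 0 then 0 else T a ^ (n div 2))"
proof (cases "a = 0")
  case False
  have eq: "{k. k < n \<and> [2 * k = 0] (mod n)} = {0, n div 2}"
  proof (intro equalityI subsetI)
    fix k assume "k \<in> {k. k < n \<and> [2 * k = 0] (mod n)}"
    then obtain m where m: "2 * k = n * m" "k < n"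
      by (auto simp: cong_0_iff)
    then have "n * m < n * 2"
      by linarith
    then have "m = 0 \<or> m = 1"
      by auto
    then show "k \<in> {0, n div 2}"
      using m by auto
  qed (use assms n_pos in \<open>auto simp: cong_0_iff\<close>)
  have "{y. y ^ 2 = a} = {y. y \<noteq> 0 \<and> y ^ 2 = a}"
    using False by auto
  then have "of_nat (card {y. y ^ 2 = a}) = (\<Sum>y | y \<noteq> 0 \<and> y ^ 2 = a. T y ^ 0)"
    by simp
  also have "\<dots> = (\<Sum>k\<in>{0, n div 2}. T a ^ k)"
    unfolding sum_char_over_roots[OF False] eq ..
  also have "\<dots> = 1 + T a ^ (n div 2)"
    using assms n_pos by auto
  finally show ?thesis
    using False by simp
qed simp

lemma curve_points_eq:
  assumes "even n" "d \<ge> 2" "c \<noteq> 0"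
  defines "\<phi> \<equiv> \<lambda>x. if x = 0 then 0 else T x ^ (n div 2)"
  shows "of_nat (curve_points d c) = of_nat (CARD('a)) + 1 +
    (\<Sum>k | k < n \<and> [(d - 1) * k = n div 2] (mod n).
       T (- c) ^ k * \<phi> c * jacobi_sum (\<lambda>x. if x = 0 then 0 else T x ^ k) \<phi>)"
proof -
  let ?K = "{k. k < n \<and> [(d - 1) * k = n div 2] (mod n)}"
  have \<phi>_0: "\<phi> 0 = 0"
    by (simp add: \<phi>_def)
  have \<phi>_mult: "\<phi> (x * y) = \<phi> x * \<phi> y" for x y
    by (simp add: \<phi>_def char_mult power_mult_distrib)
  have factor: "\<phi> (x ^ d + c * x) = \<phi> c * (\<phi> x * \<phi> (1 - x ^ (d - 1) / (- c)))" for x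
  proof -
    have "x ^ d + c * x = c * (x * (1 - x ^ (d - 1) / (- c)))"
      using assms(2,3) by (cases d) (simp_all add: field_simps)
    then show ?thesis
      by (simp only: \<phi>_mult)
  qed
  \<comment> \<open>Over \<open>u = 0\<close> the fibre is empty. Elsewhere the sum runs over the
    roots of \<open>x ^ (d - 1) = - c * u\<close>, with \<open>j = n div 2\<close> because \<phi> is
    the power of \<open>T\<close> with that exponent.\<close>
  have fibre: "(\<Sum>x | x \<noteq> 0 \<and> x ^ (d - 1) / (- c) = u. \<phi> x) =
      (\<Sum>k\<in>?K. T (- c) ^ k * (if u = 0 then 0 else T u ^ k))" for u
  proof (cases "u = 0")
    case True
    then have "{x. x \<noteq> 0 \<and> x ^ (d - 1) / (- c) = u} = {}"
      using assms(3) by auto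
    with True show ?thesis
      by (simp only: sum.empty) simp
  next
    case False
    have "{x. x \<noteq> 0 \<and> x ^ (d - 1) / (- c) = u} = {x. x \<noteq> 0 \<and> x ^ (d - 1) = - c * u}"
      using assms(3) by (auto simp: divide_eq_eq mult.commute)
    then have "(\<Sum>x | x \<noteq> 0 \<and> x ^ (d - 1) / (- c) = u. \<phi> x) =
        (\<Sum>x | x \<noteq> 0 \<and> x ^ (d - 1) = - c * u. T x ^ (n div 2))"
      by (intro sum.cong) (auto simp: \<phi>_def)
    also have "\<dots> = (\<Sum>k\<in>?K. T (- c * u) ^ k)"
      using assms(3) False by (intro sum_char_over_roots) auto
    also have "\<dots> = (\<Sum>k\<in>?K. T (- c) ^ k * T u ^ k)"
      by (simp only: char_mult power_mult_distrib)
    finally show ?thesis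
      using False by simp
  qed
  have "{(x, y). y ^ 2 = x ^ d + c * x} = (SIGMA x:UNIV. {y. y ^ 2 = x ^ d + c * x})"
    by auto
  then have "of_nat (card {(x, y). y ^ 2 = x ^ d + c * x}) =
      (\<Sum>x\<in>UNIV. of_nat (card {y. y ^ 2 = x ^ d + c * x}) :: complex)"
    by simp
  also have "\<dots> = of_nat (CARD('a)) + (\<Sum>x\<in>UNIV. \<phi> (x ^ d + c * x))"
    by (simp only: card_square_roots[OF assms(1)] \<phi>_def sum.distrib) simp
  also have "(\<Sum>x\<in>UNIV. \<phi> (x ^ d + c * x)) =
      \<phi> c * (\<Sum>x\<in>UNIV. \<phi> x * \<phi> (1 - x ^ (d - 1) / (- c)))"
    by (simp only: factor sum_distrib_left)
  \<comment> \<open>Removing \<open>x = 0\<close>, where \<phi> vanishes, leaves only units, as the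
    root sums require.\<close>
  also have "(\<Sum>x\<in>UNIV. \<phi> x * \<phi> (1 - x ^ (d - 1) / (- c))) =
      (\<Sum>x\<in>UNIV - {0}. \<phi> x * \<phi> (1 - x ^ (d - 1) / (- c)))"
    by (rule sum.mono_neutral_right) (auto simp: \<phi>_0)
  also have "\<dots> = (\<Sum>u\<in>UNIV. \<Sum>x | x \<in> UNIV - {0} \<and> x ^ (d - 1) / (- c) = u.
      \<phi> x * \<phi> (1 - x ^ (d - 1) / (- c)))"
    by (rule sum.group[symmetric]) auto
  also have "\<dots> = (\<Sum>u\<in>UNIV. (\<Sum>x | x \<noteq> 0 \<and> x ^ (d - 1) / (- c) = u. \<phi> x) * \<phi> (1 - u))"
    unfolding sum_distrib_right by (intro sum.cong) auto
  also have "\<dots> = (\<Sum>u\<in>UNIV. \<Sum>k\<in>?K. T (- c) ^ k * ((if u = 0 then 0 else T u ^ k) * \<phi> (1 - u)))"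
    by (simp only: fibre sum_distrib_right mult.assoc)
  also have "\<dots> = (\<Sum>k\<in>?K. T (- c) ^ k * jacobi_sum (\<lambda>x. if x = 0 then 0 else T x ^ k) \<phi>)"
    unfolding jacobi_sum_def sum_distrib_left by (rule sum.swap)
  finally show ?thesis
    by (simp add: curve_points_def sum_distrib_left mult_ac)
qed

end

section \<open>Matching the exponents with the index set\<close>

text \<open>With \<open>p - 1 = 2 * h\<close> and \<open>r = d - 1\<close>, both sides express
  \<open>r * k = (2 * m + 1) * h\<close>: being congruent to \<open>h\<close> modulo
  \<open>2 * h\<close> means being an odd multiple of \<open>h\<close>. Since \<open>h > 0\<close>,
  the exponent \<open>k\<close> determines \<open>m\<close>.\<close>

lemma bij_betw_char_exponent:
  assumes "odd p" "p \<ge> 2" "d \<ge> 2"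
  shows "bij_betw (\<lambda>m. nat (char_exponent p d m)) (index_set p d)
    {k. k < p - 1 \<and> [(d - 1) * k = (p - 1) div 2] (mod (p - 1))}"
proof -
  obtain h where h: "p = 2 * h + 1"
    using assms(1) by (rule oddE)
  have "h > 0"
    using h assms(2) by simp
  define r where "r = d - 1"
  have r: "r > 0" "int d - 1 = int r"
    using assms(3) by (auto simp: r_def)
  \<comment> \<open>Divisibility is the same as exactness of the quotient; a factor 2 cancels from
    the resulting equation.\<close>
  have exponent: "m \<in> index_set p d \<longleftrightarrow> 0 \<le> char_exponent p d m \<and> char_exponent p d m < 2 * int h \<and>
      int r * char_exponent p d m = (2 * m + 1) * int h" for m
  proof -
    have "int r * char_exponent p d m = (2 * m + 1) * int h \<longleftrightarrow>
        2 * int r * char_exponent p d m = (2 * m + 1) * (int p - 1)"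
      by (auto simp: h)
    also have "\<dots> \<longleftrightarrow> 2 * (int d - 1) dvd (2 * m + 1) * (int p - 1)"
      unfolding char_exponent_def r(2) by (metis dvd_mult_div_cancel dvd_triv_left)
    finally show ?thesis
      by (auto simp: index_set_def h)
  qed
  have exponent_eq: "char_exponent p d m = int k" if "int r * int k = (2 * m + 1) * int h" for m k
  proof -
    have "(2 * m + 1) * (int p - 1) = (2 * int r) * int k"
      using that by (simp add: h algebra_simps)
    then show ?thesis
      using r by (simp add: char_exponent_def)
  qed
  have cong: "[r * k = h] (mod (2 * h)) \<longleftrightarrow> (\<exists>m. int r * int k = (2 * m + 1) * int h)" for k
  proof -
    have "[r * k = h] (mod (2 * h)) \<longleftrightarrow> int (2 * h) dvd int r * int k - int h"
      by (simp add: cong_iff_dvd_diff flip: cong_int_iff)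
    also have "\<dots> \<longleftrightarrow> (\<exists>m. int r * int k - int h = int (2 * h) * m)"
      by (simp only: dvd_def)
    also have "\<dots> \<longleftrightarrow> (\<exists>m. int r * int k = (2 * m + 1) * int h)"
      by (simp add: algebra_simps)
    finally show ?thesis .
  qed
  show ?thesis
    unfolding bij_betw_def
  proof
    show "inj_on (\<lambda>m. nat (char_exponent p d m)) (index_set p d)"
    proof (rule inj_onI)
      fix m m' assume *: "m \<in> index_set p d" "m' \<in> index_set p d"
        "nat (char_exponent p d m) = nat (char_exponent p d m')"
      then have "(2 * m + 1) * int h = (2 * m' + 1) * int h"
        unfolding exponent by (metis eq_nat_nat_iff)
      with \<open>h > 0\<close> show "m = m'"
        by simp
    qed
    show "(\<lambda>m. nat (char_exponent p d m)) ` index_set p d =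
      {k. k < p - 1 \<and> [(d - 1) * k = (p - 1) div 2] (mod (p - 1))}"
    proof (intro equalityI subsetI)
      fix k assume "k \<in> (\<lambda>m. nat (char_exponent p d m)) ` index_set p d"
      then obtain m where m: "m \<in> index_set p d" "k = nat (char_exponent p d m)"
        by blast
      then have "int k = char_exponent p d m"
        using exponent by simp
      with m have "k < 2 * h" "int r * int k = (2 * m + 1) * int h"
        using exponent[of m] by auto
      then show "k \<in> {k. k < p - 1 \<and> [(d - 1) * k = (p - 1) div 2] (mod (p - 1))}"
        using cong[of k] by (auto simp: h r_def)
    next
      fix k assume "k \<in> {k. k < p - 1 \<and> [(d - 1) * k = (p - 1) div 2] (mod (p - 1))}"
      then obtain m where m: "k < 2 * h" "int r * int k = (2 * m + 1) * int h"
        using cong[of k] by (auto simp: h r_def)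
      then have "m \<in> index_set p d" "nat (char_exponent p d m) = k"
        using exponent_eq[OF m(2)] by (auto simp: exponent)
      then show "k \<in> (\<lambda>m. nat (char_exponent p d m)) ` index_set p d"
        by blast
    qed
  qed
qed

theorem theoremB1:
  fixes p d :: nat
    and c :: "'p::prime_card mod_ring"
    and T \<phi> :: "'p mod_ring \<Rightarrow> complex"
  assumes "p = CARD('p)" and "prime p" and "odd p"
    and "d \<ge> 2"
    and "c \<noteq> 0"
    and "is_generator mult_chars T"
    and "\<phi> = T [^]\<^bsub>mult_chars\<^esub> ((p - 1) div 2)"
  shows "of_nat (curve_points d c) =
    of_nat p + 1 +
    (\<Sum>m\<in>index_set p d.
       (T [^]\<^bsub>mult_chars\<^esub> char_exponent p d m) (- c) * \<phi> c *
       jacobi_sum (T [^]\<^bsub>mult_chars\<^esub> char_exponent p d m) \<phi>)"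
proof -
  have T: "T \<in> carrier mult_chars"
    using assms(6) by (simp add: is_generator_def)
  interpret faithful_character T "CARD('p mod_ring) - 1"
    using T generator_faithful[OF assms(6)] by unfold_locales (auto simp: mult_chars_def)
  have card: "CARD('p mod_ring) = p"
    using assms(1) by simp
  have pow: "T [^]\<^bsub>mult_chars\<^esub> k = (\<lambda>x. if x = 0 then 0 else T x ^ k)" for k :: nat
    by (rule ext) (rule mult_chars_nat_pow[OF T])
  \<comment> \<open>Exponents from the index set are nonnegative, so integer powers reduce to
    natural ones.\<close>
  have int_pow: "T [^]\<^bsub>mult_chars\<^esub> char_exponent p d m =
      T [^]\<^bsub>mult_chars\<^esub> nat (char_exponent p d m)" if "m \<in> index_set p d" for m
  proof -
    have "char_exponent p d m = int (nat (char_exponent p d m))"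
      using that by (simp add: index_set_def)
    then show ?thesis
      by (metis int_pow_int)
  qed
  have "of_nat (curve_points d c) = of_nat p + 1 +
      (\<Sum>k | k < p - 1 \<and> [(d - 1) * k = (p - 1) div 2] (mod (p - 1)).
         (T [^]\<^bsub>mult_chars\<^esub> k) (- c) * \<phi> c * jacobi_sum (T [^]\<^bsub>mult_chars\<^esub> k) \<phi>)"
    using curve_points_eq[of d c] assms(3-5) unfolding assms(7) pow card by simp
  also have "(\<Sum>k | k < p - 1 \<and> [(d - 1) * k = (p - 1) div 2] (mod (p - 1)).
         (T [^]\<^bsub>mult_chars\<^esub> k) (- c) * \<phi> c * jacobi_sum (T [^]\<^bsub>mult_chars\<^esub> k) \<phi>) =
      (\<Sum>m\<in>index_set p d.
         (T [^]\<^bsub>mult_chars\<^esub> nat (char_exponent p d m)) (- c) * \<phi> c *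
         jacobi_sum (T [^]\<^bsub>mult_chars\<^esub> nat (char_exponent p d m)) \<phi>)"
    using assms(2-4) by (intro sum.reindex_bij_betw[symmetric] bij_betw_char_exponent)
      (auto simp: prime_ge_2_nat)
  finally show ?thesis
    by (simp add: int_pow)
qed

end
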